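(* Let $m\ge0$ be an integer and let $h_1,h_2\in C^\infty(\mathbb{R})$ be such that $h_2-h_1$ vanishes only at $x=0$ and has there a zero of order exactly $m+1$. Let $\Gamma_i=\{(x,h_i(x)) : x\in\mathbb{R}\}\subset\mathbb{R}^2$ and $\mathbb{K}_m=\Gamma_1\cup\Gamma_2$. Then $$C^{\infty}(\mathbb{R}^2)|_{\mathbb{K}_m} = \{(f,g)\in C^\infty(\mathbb{R})\times C^\infty(\mathbb{R})\mid f(x)-g(x)=o(x^m)\ \text{as } x\to0\},$$ where a function $u$ on $\mathbb{K}_m$ is identified with the pair $(f,g)$, $f(x)=u(x,h_1(x))$, $g(x)=u(x,h_2(x))$.
   Context: $C^{\infty}(\mathbb{R}^2)|_{\mathbb{K}_m}$ denotes the algebra of restrictions to $\mathbb{K}_m$ of smooth real functions on $\mathbb{R}^2$. The curves $\Gamma_1,\Gamma_2$ are said to have contact of order $m$ at their unique common point, over $x=0$. A smooth function $h$ has a zero of order exactly $m+1$ at $0$ if $h^{(i)}(0)=0$ for $0\le i\le m$ and $h^{(m+1)}(0)\neq0$. *)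

theory Defs
  imports "HOL-Analysis.Analysis" "HOL-Library.Landau_Symbols" "HOL-Library.FuncSet"
begin

text \<open>
  Differentiability of class \<open>C\<^sup>k\<close> on the whole space. In finite dimension a differentiable
  map is of class \<open>C\<^sup>k\<^sup>+\<^sup>1\<close> iff each of its directional derivatives is of class \<open>C\<^sup>k\<close>.
\<close>

primrec C_k :: "nat \<Rightarrow> ('a::euclidean_space \<Rightarrow> 'b::euclidean_space) \<Rightarrow> bool" where
  "C_k 0 f \<longleftrightarrow> continuous_on UNIV f"
| "C_k (Suc k) f \<longleftrightarrow> (\<forall>x. f differentiable (at x)) \<and>
     (\<forall>v. C_k k (\<lambda>x. frechet_derivative f (at x) v))"

definition smooth :: "('a::euclidean_space \<Rightarrow> 'b::euclidean_space) \<Rightarrow> bool" where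
  "smooth f \<longleftrightarrow> (\<forall>k. C_k k f)"

definition zero_of_exact_order :: "(real \<Rightarrow> real) \<Rightarrow> nat \<Rightarrow> real \<Rightarrow> bool" where
  "zero_of_exact_order h n x \<longleftrightarrow> (\<forall>i<n. (deriv ^^ i) h x = 0) \<and> (deriv ^^ n) h x \<noteq> 0"

definition curve :: "(real \<Rightarrow> real) \<Rightarrow> (real \<times> real) set" where
  "curve h = {(x, h x) |x. x \<in> UNIV}"

text \<open>
  A function on a subset \<open>K\<close> of the plane is represented by its extensional representative
  (equal to \<open>undefined\<close> outside \<open>K\<close>), so that equality of representatives is equality on \<open>K\<close>.
\<close>

definition smooth_restrictions :: "(real \<times> real) set \<Rightarrow> (real \<times> real \<Rightarrow> real) set" where
  "smooth_restrictions K = {restrict F K |F. smooth F}"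

definition curve_pair ::
  "(real \<Rightarrow> real) \<Rightarrow> (real \<Rightarrow> real) \<Rightarrow> (real \<times> real \<Rightarrow> real) \<Rightarrow> (real \<Rightarrow> real) \<times> (real \<Rightarrow> real)" where
  "curve_pair h1 h2 u = (\<lambda>x. u (x, h1 x), \<lambda>x. u (x, h2 x))"

end

theory Submission
  imports Defs
begin

text \<open>
  Everything rests on dividing smooth functions by powers of \<open>x\<close>. By Hadamard's lemma a smooth
  function that vanishes at \<open>0\<close> is \<open>x\<close> times a smooth function; iterating this, the exact order
  of the zero gives \<open>h2 - h1 = x\<^sup>m\<^sup>+\<^sup>1 H\<close> with \<open>H\<close> smooth and \<open>H 0 \<noteq> 0\<close> (lemma
  \<open>smooth_divide_power_derivs\<close>), hence \<open>H\<close> vanishes nowhere. In the same way a smooth function that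
  is \<open>o(x\<^sup>m)\<close> is already \<open>x\<^sup>m\<^sup>+\<^sup>1\<close> times a smooth function (lemma
  \<open>smooth_divide_power_smallo\<close>).

  If \<open>F\<close> is smooth on the plane, then it is locally Lipschitz in the second variable, so that
  \<open>F(x, h1 x) - F(x, h2 x) = O(h2 x - h1 x) = O(x\<^sup>m\<^sup>+\<^sup>1) = o(x\<^sup>m)\<close>. Conversely, given \<open>f\<close> and
  \<open>g\<close> with \<open>f - g = x\<^sup>m\<^sup>+\<^sup>1 G\<close>, the quotient \<open>(f - g) / (h2 - h1)\<close> is the smooth function \<open>G / H\<close>,
  and interpolating linearly in \<open>y\<close> between the two curves,
  \<open>F(x, y) = f x - (y - h1 x) G x / H x\<close>, gives a smooth function on the plane that restricts to \<open>f\<close>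
  and \<open>g\<close>. Injectivity is clear because every point of the union lies on one of the curves.
\<close>

section \<open>Calculus of smooth maps\<close>

lemma C_k_Suc_has_derivative:
  assumes "C_k (Suc k) f"
  shows "(f has_derivative frechet_derivative f (at x)) (at x)"
  using assms by (simp add: frechet_derivative_works)

lemma C_k_SucI:
  assumes "\<And>x. (f has_derivative f' x) (at x)" and "\<And>v. C_k k (\<lambda>x. f' x v)"
  shows "C_k (Suc k) f"
proof -
  have "frechet_derivative f (at x) = f' x" for x
    using assms(1) by (metis frechet_derivative_at)
  then show ?thesis
    using assms by (auto simp: differentiable_def)
qed

lemma C_k_Suc_imp_C_k: "C_k (Suc k) f \<Longrightarrow> C_k k f"
proof (induction k arbitrary: f)
  case 0
  then show ?case
    by (auto intro!: continuous_at_imp_continuous_on differentiable_imp_continuous_within)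
next
  case (Suc k)
  then show ?case
    by (metis C_k.simps(2))
qed

lemma C_k_const: "C_k k (\<lambda>x. c)"
proof (induction k arbitrary: c)
  case (Suc k)
  show ?case
    by (rule C_k_SucI[where f' = "\<lambda>x v. 0"]) (auto simp: Suc)
qed simp

lemma C_k_bounded_linear:
  assumes "bounded_linear f"
  shows "C_k k f"
proof (cases k)
  case 0
  then show ?thesis
    using assms by (simp add: linear_continuous_on)
next
  case (Suc j)
  show ?thesis
    unfolding Suc using assms
    by (intro C_k_SucI[where f' = "\<lambda>x. f"] C_k_const bounded_linear_imp_has_derivative)
qed

lemma C_k_linear_image:
  assumes "bounded_linear L"
  shows "C_k k f \<Longrightarrow> C_k k (\<lambda>x. L (f x))"
proof (induction k arbitrary: f)
  case 0
  then show ?case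
    using assms by (simp add: bounded_linear.continuous_on)
next
  case (Suc k)
  show ?case
  proof (rule C_k_SucI)
    show "((\<lambda>x. L (f x)) has_derivative (\<lambda>v. L (frechet_derivative f (at x) v))) (at x)" for x
      using C_k_Suc_has_derivative[OF Suc.prems] assms by (rule bounded_linear.has_derivative[rotated])
    show "C_k k (\<lambda>x. L (frechet_derivative f (at x) v))" for v
      using Suc by simp
  qed
qed

lemma C_k_add: "C_k k f \<Longrightarrow> C_k k g \<Longrightarrow> C_k k (\<lambda>x. f x + g x)"
proof (induction k arbitrary: f g)
  case 0
  then show ?case
    by (simp add: continuous_on_add)
next
  case (Suc k)
  show ?case
  proof (rule C_k_SucI)
    show "((\<lambda>x. f x + g x) has_derivative
        (\<lambda>v. frechet_derivative f (at x) v + frechet_derivative g (at x) v)) (at x)" for x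
      using Suc.prems[THEN C_k_Suc_has_derivative] by (rule has_derivative_add)
    show "C_k k (\<lambda>x. frechet_derivative f (at x) v + frechet_derivative g (at x) v)" for v
      using Suc by simp
  qed
qed

lemma C_k_sum:
  assumes "finite A" "\<And>a. a \<in> A \<Longrightarrow> C_k k (f a)"
  shows "C_k k (\<lambda>x. \<Sum>a\<in>A. f a x)"
  using assms by (induction A rule: finite_induct) (auto intro: C_k_const C_k_add)

lemma C_k_scaleR:
  fixes u :: "'a::euclidean_space \<Rightarrow> real" and f :: "'a \<Rightarrow> 'b::euclidean_space"
  shows "C_k k u \<Longrightarrow> C_k k f \<Longrightarrow> C_k k (\<lambda>x. u x *\<^sub>R f x)"
proof (induction k arbitrary: u f)
  case 0
  then show ?case
    by (simp add: continuous_on_scaleR)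
next
  case (Suc k)
  show ?case
  proof (rule C_k_SucI)
    show "((\<lambda>x. u x *\<^sub>R f x) has_derivative
        (\<lambda>v. u x *\<^sub>R frechet_derivative f (at x) v + frechet_derivative u (at x) v *\<^sub>R f x)) (at x)" for x
      using Suc.prems[THEN C_k_Suc_has_derivative] by (rule has_derivative_scaleR)
    show "C_k k (\<lambda>x. u x *\<^sub>R frechet_derivative f (at x) v
        + frechet_derivative u (at x) v *\<^sub>R f x)" for v
      using Suc.prems C_k_Suc_imp_C_k[OF Suc.prems(1)] C_k_Suc_imp_C_k[OF Suc.prems(2)]
      by (intro C_k_add Suc.IH) auto
  qed
qed

lemma C_k_mult:
  fixes f g :: "'a::euclidean_space \<Rightarrow> real"
  shows "C_k k f \<Longrightarrow> C_k k g \<Longrightarrow> C_k k (\<lambda>x. f x * g x)"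
  using C_k_scaleR[of k f g] by simp

lemma C_k_inverse:
  fixes f :: "'a::euclidean_space \<Rightarrow> real"
  assumes "\<And>x. f x \<noteq> 0"
  shows "C_k k f \<Longrightarrow> C_k k (\<lambda>x. inverse (f x))"
proof (induction k)
  case 0
  then show ?case
    using assms by (simp add: continuous_on_inverse)
next
  case (Suc k)
  show ?case
  proof (rule C_k_SucI)
    show "((\<lambda>x. inverse (f x)) has_derivative
        (\<lambda>v. (- 1) * (inverse (f x) * frechet_derivative f (at x) v * inverse (f x)))) (at x)" for x
      using Deriv.has_derivative_inverse[OF assms C_k_Suc_has_derivative[OF Suc.prems]] by simp
    show "C_k k (\<lambda>x. (- 1) * (inverse (f x) * frechet_derivative f (at x) v * inverse (f x)))" for v
      using Suc.prems Suc.IH[OF C_k_Suc_imp_C_k[OF Suc.prems]]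
      by (intro C_k_mult C_k_const) auto
  qed
qed

text \<open>
  The chain rule only gives a derivative of the form \<open>Df (g x) (Dg x v)\<close>, in which the direction
  fed to \<open>Df\<close> varies with \<open>x\<close>. Expanding \<open>Dg x v\<close> in the standard basis turns it into a sum of
  products of directional derivatives in fixed directions, to which the induction applies.
\<close>

lemma C_k_compose:
  fixes g :: "'a::euclidean_space \<Rightarrow> 'b::euclidean_space" and f :: "'b \<Rightarrow> 'c::euclidean_space"
  shows "C_k k f \<Longrightarrow> C_k k g \<Longrightarrow> C_k k (\<lambda>x. f (g x))"
proof (induction k arbitrary: f g)
  case 0
  then show ?case
    by (auto intro: continuous_on_compose2)
next
  case (Suc k)
  note Df = C_k_Suc_has_derivative[OF Suc.prems(1)]
  note Dg = C_k_Suc_has_derivative[OF Suc.prems(2)]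
  show ?case
  proof (rule C_k_SucI)
    fix x
    let ?L = "frechet_derivative f (at (g x))"
    have L: "linear ?L"
      using Df has_derivative_linear by blast
    have expand: "?L w = (\<Sum>b\<in>Basis. (w \<bullet> b) *\<^sub>R ?L b)" for w
    proof -
      have "?L w = ?L (\<Sum>b\<in>Basis. (w \<bullet> b) *\<^sub>R b)"
        by (simp only: euclidean_representation)
      also have "\<dots> = (\<Sum>b\<in>Basis. ?L ((w \<bullet> b) *\<^sub>R b))"
        by (rule linear_sum[OF L])
      finally show ?thesis
        by (simp only: linear_scale[OF L])
    qed
    show "((\<lambda>x. f (g x)) has_derivative (\<lambda>v. \<Sum>b\<in>Basis.
        (frechet_derivative g (at x) v \<bullet> b) *\<^sub>R frechet_derivative f (at (g x)) b)) (at x)"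
      unfolding expand[symmetric] by (rule has_derivative_compose[OF Dg Df])
  next
    fix v
    have "C_k k (\<lambda>x. frechet_derivative g (at x) v \<bullet> b)" for b
      using Suc.prems(2) by (intro C_k_linear_image[OF bounded_linear_inner_left]) simp
    moreover have "C_k k (\<lambda>x. frechet_derivative f (at (g x)) b)" for b
      using Suc.prems(1) C_k_Suc_imp_C_k[OF Suc.prems(2)]
      by (intro Suc.IH[where f = "\<lambda>y. frechet_derivative f (at y) b"]) auto
    ultimately show "C_k k (\<lambda>x. \<Sum>b\<in>Basis.
        (frechet_derivative g (at x) v \<bullet> b) *\<^sub>R frechet_derivative f (at (g x)) b)"
      by (intro C_k_sum C_k_scaleR) auto
  qed
qed

lemma smooth_const: "smooth (\<lambda>x. c)"
  by (simp add: smooth_def C_k_const)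

lemma smooth_bounded_linear: "bounded_linear f \<Longrightarrow> smooth f"
  by (simp add: smooth_def C_k_bounded_linear)

lemma smooth_add: "smooth f \<Longrightarrow> smooth g \<Longrightarrow> smooth (\<lambda>x. f x + g x)"
  by (simp add: smooth_def C_k_add)

lemma smooth_mult:
  fixes f g :: "'a::euclidean_space \<Rightarrow> real"
  shows "smooth f \<Longrightarrow> smooth g \<Longrightarrow> smooth (\<lambda>x. f x * g x)"
  by (simp add: smooth_def C_k_mult)

lemma smooth_diff:
  fixes f g :: "'a::euclidean_space \<Rightarrow> 'b::euclidean_space"
  assumes "smooth f" "smooth g"
  shows "smooth (\<lambda>x. f x - g x)"
proof -
  have "smooth (\<lambda>x. - g x)"
    using assms(2) by (simp add: smooth_def C_k_linear_image[OF bounded_linear_minus[OF bounded_linear_ident]])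
  then show ?thesis
    using smooth_add[OF assms(1)] by force
qed

lemma smooth_inverse:
  fixes f :: "'a::euclidean_space \<Rightarrow> real"
  shows "smooth f \<Longrightarrow> (\<And>x. f x \<noteq> 0) \<Longrightarrow> smooth (\<lambda>x. inverse (f x))"
  by (simp add: smooth_def C_k_inverse)

lemma smooth_compose:
  fixes g :: "'a::euclidean_space \<Rightarrow> 'b::euclidean_space" and f :: "'b \<Rightarrow> 'c::euclidean_space"
  shows "smooth f \<Longrightarrow> smooth g \<Longrightarrow> smooth (\<lambda>x. f (g x))"
  by (simp add: smooth_def C_k_compose)

lemma smooth_graph:
  fixes h :: "'a::euclidean_space \<Rightarrow> 'b::euclidean_space"
  assumes "smooth h"
  shows "smooth (\<lambda>x. (x, h x))"
proof -
  have "smooth (\<lambda>x. (0::'a, h x))"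
    using assms unfolding smooth_def
    by (intro allI C_k_linear_image[where L = "\<lambda>y. (0, y)"] bounded_linear_Pair bounded_linear_zero
        bounded_linear_ident) auto
  moreover have "smooth (\<lambda>x::'a. (x, 0::'b))"
    by (intro smooth_bounded_linear bounded_linear_Pair bounded_linear_zero bounded_linear_ident)
  ultimately show ?thesis
    using smooth_add[of "\<lambda>x. (x, 0)" "\<lambda>x. (0, h x)"] by simp
qed

lemma smooth_has_derivative:
  "smooth f \<Longrightarrow> (f has_derivative frechet_derivative f (at x)) (at x)"
  by (meson C_k_Suc_has_derivative smooth_def)

lemma smooth_directional_derivative:
  "smooth f \<Longrightarrow> smooth (\<lambda>x. frechet_derivative f (at x) v)"
  by (metis C_k.simps(2) smooth_def)

lemma smooth_continuous_on: "smooth f \<Longrightarrow> continuous_on S f"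
  by (metis C_k.simps(1) smooth_def continuous_on_subset subset_UNIV)

lemma smooth_has_real_derivative:
  fixes f :: "real \<Rightarrow> real"
  assumes "smooth f"
  shows "(f has_real_derivative deriv f x) (at x)"
  by (simp add: DERIV_deriv_iff_real_differentiable differentiableI[OF smooth_has_derivative[OF assms]])

lemma smooth_deriv:
  fixes f :: "real \<Rightarrow> real"
  assumes "smooth f"
  shows "smooth (deriv f)"
proof -
  have "frechet_derivative f (at x) = (\<lambda>v. deriv f x * v)" for x
    using smooth_has_real_derivative[OF assms] unfolding has_field_derivative_def
    by (metis frechet_derivative_at)
  then show ?thesis
    using smooth_directional_derivative[OF assms, of 1] by simp
qed

section \<open>Division by powers of the variable\<close>

text \<open>
  The weight \<open>w\<close> makes the family of these integrals closed under differentiation, which replaces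
  \<open>w t\<close> by \<open>w t * t\<close> and \<open>f\<close> by its derivative; smoothness of the integral then follows by
  induction on the order.
\<close>

lemma has_real_derivative_dilation_integral:
  fixes f w :: "real \<Rightarrow> real"
  assumes f: "smooth f" and w: "continuous_on {0..1} w"
  shows "((\<lambda>x. integral {0..1} (\<lambda>t. w t * f (t * x))) has_real_derivative
    integral {0..1} (\<lambda>t. (w t * t) * deriv f (t * x))) (at x)"
proof -
  have "((\<lambda>x. integral (cbox 0 1) (\<lambda>t. w t * f (t * x))) has_field_derivative
    integral (cbox 0 1) (\<lambda>t. (w t * t) * deriv f (t * x))) (at x within UNIV)"
  proof (rule leibniz_rule_field_derivative)
    fix x t :: real
    have "((\<lambda>x. f (t * x)) has_real_derivative deriv f (t * x) * t) (at x)"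
      by (rule DERIV_chain2[OF smooth_has_real_derivative[OF f]]) (auto intro!: derivative_eq_intros)
    then show "((\<lambda>x. w t * f (t * x)) has_real_derivative (w t * t) * deriv f (t * x)) (at x within UNIV)"
      using DERIV_cmult by (fastforce simp: mult_ac)
  next
    fix x :: real
    show "(\<lambda>t. w t * f (t * x)) integrable_on cbox 0 1"
      using w by (intro integrable_continuous continuous_intros
          continuous_on_compose2[OF smooth_continuous_on[OF f, of UNIV]]) auto
  next
    show "continuous_on (UNIV \<times> cbox 0 1) (\<lambda>(x, t). w t * t * deriv f (t * x))"
      unfolding split_beta
      by (intro continuous_intros continuous_on_compose2[OF w]
          continuous_on_compose2[OF smooth_continuous_on[OF smooth_deriv[OF f], of UNIV]]) auto
  qed auto
  then show ?thesis
    by simp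
qed

lemma smooth_dilation_integral:
  fixes f w :: "real \<Rightarrow> real"
  assumes "smooth f" and "continuous_on {0..1} w"
  shows "smooth (\<lambda>x. integral {0..1} (\<lambda>t. w t * f (t * x)))"
proof -
  have "C_k k (\<lambda>x. integral {0..1} (\<lambda>t. w t * f (t * x)))" for k
    using assms
  proof (induction k arbitrary: f w)
    case 0
    then show ?case
      using has_real_derivative_dilation_integral[OF 0]
      by (auto intro!: continuous_at_imp_continuous_on DERIV_isCont)
  next
    case (Suc k)
    show ?case
    proof (rule C_k_SucI)
      show "((\<lambda>x. integral {0..1} (\<lambda>t. w t * f (t * x))) has_derivative
        (\<lambda>v. integral {0..1} (\<lambda>t. (w t * t) * deriv f (t * x)) * v)) (at x)" for x
        using has_real_derivative_dilation_integral[OF Suc.prems]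
        by (simp add: has_field_derivative_def)
      have "C_k k (\<lambda>x. integral {0..1} (\<lambda>t. (w t * t) * deriv f (t * x)))"
        using Suc.prems by (intro Suc.IH smooth_deriv continuous_intros)
      then show "C_k k (\<lambda>x. integral {0..1} (\<lambda>t. (w t * t) * deriv f (t * x)) * v)" for v
        by (intro C_k_mult C_k_const)
    qed
  qed
  then show ?thesis
    by (simp add: smooth_def)
qed

text \<open>
  The quotient is \<open>\<integral>\<^sub>0\<^sup>1 f' (t x) dt\<close>: multiplied by \<open>x\<close>, the integrand becomes the derivative of
  \<open>t \<mapsto> f (t x)\<close>.
\<close>

lemma Hadamard_division:
  fixes f :: "real \<Rightarrow> real"
  assumes f: "smooth f" and "f 0 = 0"
  obtains g where "smooth g" "\<And>x. f x = x * g x"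
proof
  let ?g = "\<lambda>x. integral {0..1} (\<lambda>t. 1 * deriv f (t * x))"
  show "smooth ?g"
    using f by (intro smooth_dilation_integral smooth_deriv continuous_intros)
  show "f x = x * ?g x" for x
  proof -
    have "((\<lambda>t. f (t * x)) has_real_derivative deriv f (t * x) * x) (at t)" for t
      by (rule DERIV_chain2[OF smooth_has_real_derivative[OF f]]) (auto intro!: derivative_eq_intros)
    then have "((\<lambda>t. f (t * x)) has_vector_derivative x * deriv f (t * x)) (at t within {0..1})" for t
      by (metis has_field_derivative_at_within has_real_derivative_iff_has_vector_derivative mult.commute)
    then have "((\<lambda>t. x * deriv f (t * x)) has_integral f (1 * x) - f (0 * x)) {0..1}"
      by (intro fundamental_theorem_of_calculus) auto
    then have "integral {0..1} (\<lambda>t. x * deriv f (t * x)) = f (1 * x) - f (0 * x)"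
      by (rule integral_unique)
    then show ?thesis
      using assms(2) by simp
  qed
qed

lemma deriv_power_times_at_0:
  fixes f :: "real \<Rightarrow> real"
  assumes "smooth f"
  shows "(deriv ^^ n) (\<lambda>x. x ^ n * f x) 0 = fact n * f 0"
  using assms
proof (induction n arbitrary: f)
  case (Suc n)
  let ?g = "\<lambda>x. real (Suc n) * f x + x * deriv f x"
  have "deriv (\<lambda>x. x ^ Suc n * f x) x = x ^ n * ?g x" for x
    by (rule DERIV_imp_deriv,
        rule DERIV_cong[OF DERIV_mult[OF DERIV_pow smooth_has_real_derivative[OF Suc.prems]]])
      (simp add: algebra_simps)
  then have "deriv (\<lambda>x. x ^ Suc n * f x) = (\<lambda>x. x ^ n * ?g x)"
    by blast
  then have "(deriv ^^ Suc n) (\<lambda>x. x ^ Suc n * f x) 0 = (deriv ^^ n) (\<lambda>x. x ^ n * ?g x) 0"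
    by (simp add: funpow_swap1)
  also have "\<dots> = fact n * ?g 0"
    using Suc.prems
    by (intro Suc.IH smooth_add smooth_mult smooth_const smooth_deriv
        smooth_bounded_linear[OF bounded_linear_ident])
  finally show ?case
    by simp
qed simp

lemma smooth_divide_power_derivs:
  fixes f :: "real \<Rightarrow> real"
  assumes f: "smooth f" and "\<And>i. i < n \<Longrightarrow> (deriv ^^ i) f 0 = 0"
  obtains g where "smooth g" "\<And>x. f x = x ^ n * g x" "(deriv ^^ n) f 0 = fact n * g 0"
proof -
  have "\<exists>g. smooth g \<and> (\<forall>x. f x = x ^ n * g x)"
    using assms(2)
  proof (induction n)
    case 0
    then show ?case
      using f by auto
  next
    case (Suc n)
    then obtain g where g: "smooth g" "\<And>x. f x = x ^ n * g x"
      by (meson less_Suc_eq)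
    then have "f = (\<lambda>x. x ^ n * g x)"
      by blast
    then have "g 0 = 0"
      using deriv_power_times_at_0[OF g(1), of n] Suc.prems[of n] by simp
    then obtain k where "smooth k" "\<And>x. g x = x * k x"
      using Hadamard_division[OF g(1)] by blast
    then show ?case
      using g(2) by (auto simp: mult_ac)
  qed
  then obtain g where g: "smooth g" "\<And>x. f x = x ^ n * g x"
    by blast
  then have "f = (\<lambda>x. x ^ n * g x)"
    by blast
  then show ?thesis
    using that[OF g] deriv_power_times_at_0[OF g(1), of n] by simp
qed

text \<open>
  A smooth function cannot decay at an order strictly between \<open>x\<^sup>m\<close> and \<open>x\<^sup>m\<^sup>+\<^sup>1\<close>: being \<open>o(x\<^sup>m)\<close>
  says that the cofactor of \<open>x\<^sup>m\<close> tends to \<open>0\<close>, and a smooth cofactor that vanishes at \<open>0\<close>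
  contributes one more factor \<open>x\<close>.
\<close>

lemma smooth_divide_power_smallo:
  fixes f :: "real \<Rightarrow> real"
  assumes f: "smooth f" and "f \<in> o[at 0](\<lambda>x. x ^ m)"
  obtains g where "smooth g" "\<And>x. f x = x ^ (m + 1) * g x"
proof -
  have step: "\<exists>k. smooth k \<and> (\<forall>x. f x = x ^ Suc n * k x)"
    if g: "smooth g" "\<And>x. f x = x ^ n * g x" and o: "f \<in> o[at 0](\<lambda>x. x ^ n)" for n g
  proof -
    have "((\<lambda>x. f x / x ^ n) \<longlongrightarrow> 0) (at 0)"
      using o by (rule smalloD_tendsto)
    moreover have "eventually (\<lambda>x. f x / x ^ n = g x) (at 0)"
      by (auto simp: eventually_at_filter g(2))
    ultimately have "(g \<longlongrightarrow> 0) (at 0)"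
      by (rule Lim_transform_eventually)
    moreover have "(g \<longlongrightarrow> g 0) (at 0)"
      using DERIV_isCont[OF smooth_has_real_derivative[OF g(1)]] by (simp add: isCont_def)
    ultimately have "g 0 = 0"
      using LIM_unique by blast
    then obtain k where "smooth k" "\<And>x. g x = x * k x"
      using Hadamard_division[OF g(1)] by blast
    then show ?thesis
      using g(2) by (auto simp: mult_ac)
  qed
  have "\<exists>g. smooth g \<and> (\<forall>x. f x = x ^ Suc m * g x)"
    using assms(2)
  proof (induction m)
    case 0
    then show ?case
      using step[of f 0] f by simp
  next
    case (Suc m)
    have "(\<lambda>x::real. x ^ Suc m) \<in> O[at 0](\<lambda>x. x ^ m)"
    proof (rule bigoI[where c = 1])
      have "eventually (\<lambda>x::real. \<bar>x\<bar> < 1) (at 0)"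
        by (auto simp: eventually_at intro: exI[of _ 1])
      then show "eventually (\<lambda>x::real. norm (x ^ Suc m) \<le> 1 * norm (x ^ m)) (at 0)"
        by eventually_elim (auto simp: abs_mult power_abs intro: mult_left_le_one_le)
    qed
    then have "f \<in> o[at 0](\<lambda>x. x ^ m)"
      using Suc.prems landau_o.small_big_trans by blast
    then show ?case
      using Suc step by blast
  qed
  then show ?thesis
    using that by auto
qed

section \<open>Functions on the union of the two curves\<close>

text \<open>
  The derivative of \<open>F\<close> in the second variable is bounded on a compact square around the common
  point \<open>(a, h1 a)\<close>, and near \<open>a\<close> both graphs lie in that square, so the mean value inequality on
  vertical segments applies. Differentiability of \<open>F\<close> at the common point alone would leave
  an error that need not be small compared with \<open>h2 - h1\<close>.
\<close>

lemma smooth_bigo_along_graphs: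
  fixes F :: "real \<times> real \<Rightarrow> real" and h1 h2 :: "real \<Rightarrow> real"
  assumes F: "smooth F" and h1: "isCont h1 a" and h2: "isCont h2 a" and eq: "h1 a = h2 a"
  shows "(\<lambda>x. F (x, h1 x) - F (x, h2 x)) \<in> O[at a](\<lambda>x. h2 x - h1 x)"
proof -
  define d where "d = (\<lambda>p. frechet_derivative F (at p) (0, 1))"
  let ?K = "cball a 1 \<times> cball (h1 a) 1"
  have "compact (d ` ?K)"
    unfolding d_def using F
    by (intro compact_continuous_image compact_Times smooth_continuous_on smooth_directional_derivative) auto
  then obtain B where B: "\<And>p. p \<in> ?K \<Longrightarrow> \<bar>d p\<bar> \<le> B"
    using compact_imp_bounded bounded_iff by (metis imageI real_norm_def)
  have D: "((\<lambda>y. F (x, y)) has_real_derivative d (x, y)) (at y)" for x y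
  proof -
    have "((\<lambda>y. (x, y)) has_derivative (\<lambda>v. (0, v))) (at y)"
      by (auto intro!: derivative_eq_intros)
    from has_derivative_compose[OF this smooth_has_derivative[OF F]]
    have "((\<lambda>y. F (x, y)) has_derivative (\<lambda>v. frechet_derivative F (at (x, y)) (0, v))) (at y)"
      by simp
    moreover have "frechet_derivative F (at (x, y)) (v *\<^sub>R (0, 1)) = v *\<^sub>R d (x, y)" for v
      unfolding d_def
      by (rule linear_scale[OF has_derivative_linear[OF smooth_has_derivative[OF F]]])
    then have "frechet_derivative F (at (x, y)) (0, v) = d (x, y) * v" for v
      by (simp add: mult.commute)
    ultimately show ?thesis
      by (simp add: has_field_derivative_def)
  qed
  show ?thesis
  proof (rule bigoI)
    have "eventually (\<lambda>x. dist x a < 1) (at a)"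
      by (auto simp: eventually_at intro: exI[of _ 1])
    moreover have "eventually (\<lambda>x. dist (h1 x) (h1 a) < 1) (at a)"
      using h1 by (intro tendstoD) (auto simp: isCont_def)
    moreover have "eventually (\<lambda>x. dist (h2 x) (h1 a) < 1) (at a)"
      using h2 eq by (intro tendstoD) (auto simp: isCont_def)
    ultimately show "eventually (\<lambda>x. norm (F (x, h1 x) - F (x, h2 x)) \<le> B * norm (h2 x - h1 x)) (at a)"
    proof eventually_elim
      case (elim x)
      have "norm (F (x, h1 x) - F (x, h2 x)) \<le> B * norm (h1 x - h2 x)"
      proof (rule field_differentiable_bound[where S = "cball (h1 a) 1" and f' = "\<lambda>y. d (x, y)"])
        show "((\<lambda>y. F (x, y)) has_real_derivative d (x, y)) (at y within cball (h1 a) 1)" for y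
          using D has_field_derivative_at_within by blast
        show "norm (d (x, y)) \<le> B" if "y \<in> cball (h1 a) 1" for y
          using B[of "(x, y)"] that elim by (auto simp: dist_commute)
      qed (use elim in \<open>auto simp: dist_commute\<close>)
      then show ?case
        by (metis norm_minus_commute)
    qed
  qed
qed

lemma inj_on_curve_pair:
  "inj_on (curve_pair h1 h2) (smooth_restrictions (curve h1 \<union> curve h2))"
proof (rule inj_onI)
  let ?K = "curve h1 \<union> curve h2"
  fix u v
  assume "u \<in> smooth_restrictions ?K" "v \<in> smooth_restrictions ?K"
  then have ext: "u \<in> extensional ?K" "v \<in> extensional ?K"
    by (auto simp: smooth_restrictions_def)
  assume "curve_pair h1 h2 u = curve_pair h1 h2 v"
  then have "u (x, h1 x) = v (x, h1 x)" "u (x, h2 x) = v (x, h2 x)" for x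
    by (auto simp: curve_pair_def dest: fun_cong)
  then show "u = v"
    by (intro extensionalityI[OF ext]) (auto simp: curve_def)
qed

lemma curve_pair_restrict:
  "curve_pair h1 h2 (restrict F (curve h1 \<union> curve h2)) = (\<lambda>x. F (x, h1 x), \<lambda>x. F (x, h2 x))"
  by (auto simp: curve_pair_def curve_def)

theorem lemma3p1:
  fixes m :: nat and h1 h2 :: "real \<Rightarrow> real"
  assumes "smooth h1" and "smooth h2"
    and "\<forall>x. h2 x - h1 x = 0 \<longleftrightarrow> x = 0"
    and "zero_of_exact_order (\<lambda>x. h2 x - h1 x) (m + 1) 0"
  shows "bij_betw (curve_pair h1 h2)
           (smooth_restrictions (curve h1 \<union> curve h2))
           {(f, g). smooth f \<and> smooth g \<and> (\<lambda>x. f x - g x) \<in> o[at 0](\<lambda>x. x ^ m)}"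
proof -
  let ?K = "curve h1 \<union> curve h2"
  let ?P = "{(f :: real \<Rightarrow> real, g :: real \<Rightarrow> real). smooth f \<and> smooth g \<and>
    (\<lambda>x. f x - g x) \<in> o[at 0](\<lambda>x. x ^ m)}"
  obtain H where H: "smooth H" "\<And>x. h2 x - h1 x = x ^ (m + 1) * H x"
    and H0: "(deriv ^^ (m + 1)) (\<lambda>x. h2 x - h1 x) 0 = fact (m + 1) * H 0"
    using smooth_divide_power_derivs[of "\<lambda>x. h2 x - h1 x" "m + 1"] assms(4)
      smooth_diff[OF assms(2,1)] unfolding zero_of_exact_order_def by blast
  have H_nonzero: "H x \<noteq> 0" for x
  proof (cases "x = 0")
    case True
    then show ?thesis
      using H0 assms(4) by (auto simp: zero_of_exact_order_def)
  next
    case False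
    then show ?thesis
      using assms(3) H(2)[of x] by (metis mult_zero_right)
  qed
  have cont: "isCont h 0" if "smooth h" for h :: "real \<Rightarrow> real"
    using DERIV_isCont[OF smooth_has_real_derivative[OF that]] .
  have h_eq: "h1 0 = h2 0"
    using spec[OF assms(3), of 0] by simp
  have h_small: "(\<lambda>x. h2 x - h1 x) \<in> o[at 0](\<lambda>x. x ^ m)"
  proof (rule smalloI_tendsto)
    have "((\<lambda>x. x * H x) \<longlongrightarrow> 0 * H 0) (at 0)"
      using cont[OF H(1)] by (intro tendsto_mult) (auto simp: isCont_def)
    moreover have "eventually (\<lambda>x. x * H x = (h2 x - h1 x) / x ^ m) (at 0)"
      by (auto simp: eventually_at_filter H(2))
    ultimately show "((\<lambda>x. (h2 x - h1 x) / x ^ m) \<longlongrightarrow> 0) (at 0)"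
      using Lim_transform_eventually by fastforce
    show "eventually (\<lambda>x. x ^ m \<noteq> 0) (at (0::real))"
      by (rule eventually_mono[OF eventually_neq_at_within[of 0]]) simp
  qed
  have "curve_pair h1 h2 ` smooth_restrictions ?K = ?P"
  proof (intro equalityI subsetI)
    fix fg
    assume "fg \<in> curve_pair h1 h2 ` smooth_restrictions ?K"
    then obtain F where F: "smooth F" and fg: "fg = (\<lambda>x. F (x, h1 x), \<lambda>x. F (x, h2 x))"
      by (auto simp: smooth_restrictions_def curve_pair_restrict)
    have "smooth (\<lambda>x. F (x, h1 x))" "smooth (\<lambda>x. F (x, h2 x))"
      using assms(1,2) by (auto intro: smooth_compose[OF F] smooth_graph)
    moreover have "(\<lambda>x. F (x, h1 x) - F (x, h2 x)) \<in> O[at 0](\<lambda>x. h2 x - h1 x)"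
      by (intro smooth_bigo_along_graphs F cont assms(1,2) h_eq)
    then have "(\<lambda>x. F (x, h1 x) - F (x, h2 x)) \<in> o[at 0](\<lambda>x. x ^ m)"
      by (rule landau_o.big_small_trans[OF _ h_small])
    ultimately show "fg \<in> ?P"
      by (simp add: fg)
  next
    fix fg
    assume "fg \<in> ?P"
    then obtain f g where fg: "fg = (f, g)" and f: "smooth f" and g: "smooth g"
      and o: "(\<lambda>x. f x - g x) \<in> o[at 0](\<lambda>x. x ^ m)"
      by blast
    obtain G where G: "smooth G" "\<And>x. f x - g x = x ^ (m + 1) * G x"
      using smooth_divide_power_smallo[OF smooth_diff[OF f g] o] by blast
    \<comment> \<open>\<open>?q\<close> is the quotient \<open>(f - g) / (h2 - h1)\<close>, continued over the contact point \<open>0\<close>.\<close>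
    let ?q = "\<lambda>x. G x * inverse (H x)"
    let ?F = "\<lambda>p. f (fst p) - (snd p - h1 (fst p)) * ?q (fst p)"
    have fst: "smooth (fst :: real \<times> real \<Rightarrow> real)" and snd: "smooth (snd :: real \<times> real \<Rightarrow> real)"
      by (simp_all add: smooth_bounded_linear bounded_linear_fst bounded_linear_snd)
    have q: "smooth ?q"
      by (intro smooth_mult smooth_inverse G H H_nonzero)
    have "smooth ?F"
      by (intro smooth_diff smooth_mult[OF _ smooth_compose[OF q fst]] snd
          smooth_compose[OF f fst] smooth_compose[OF assms(1) fst])
    moreover have "f x - (h2 x - h1 x) * ?q x = g x" for x
    proof -
      have "(h2 x - h1 x) * ?q x = x ^ (m + 1) * G x"
        unfolding H(2) using H_nonzero[of x] by (simp add: field_simps)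
      then show ?thesis
        using G(2)[of x] by linarith
    qed
    then have "curve_pair h1 h2 (restrict ?F ?K) = fg"
      by (simp add: curve_pair_restrict fg)
    ultimately show "fg \<in> curve_pair h1 h2 ` smooth_restrictions ?K"
      unfolding smooth_restrictions_def by blast
  qed
  then show ?thesis
    using inj_on_curve_pair by (simp add: bij_betw_def)
qed

end
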